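(* Let $0\to A\xrightarrow{k} G\xrightarrow{f} X\to 0$ be an extension (short exact sequence) of precrossed modules, with $A$ regarded as a sub-precrossed module $\mathrm{Ker}(f)\subseteq G$ via $k$, and suppose that $f$ admits a reflexive graph section $\theta\colon X\to G$, i.e. a function with $f\circ\theta=1_X$, $\theta\circ s_X=s_G\circ\theta$ and $\theta\circ t_X=t_G\circ\theta$ (not necessarily a group homomorphism). For $u\in\{1,\sigma,\tau\}$, $x\in X$, $a\in A$, $g\in G$ put $$\phi_A(a)(u,x)=\theta(x)\cdot u_A(a)\cdot\theta\bigl(x\cdot f(u_A(a))\bigr)^{-1},$$ $$\phi_G(g)=(\ell_g,f(g)),\qquad \ell_g(u,x)=\theta(x)\cdot u_G(g)\cdot\theta\bigl(x\cdot f(u_G(g))\bigr)^{-1}.$$ Then $\phi_A\colon A\to A^X$ and $\phi_G\colon G\to A^X\rtimes X$ are well defined and $(\phi_A,\phi_G)$ (together with $1_X$) is a morphism of extensions of precrossed modules over $X$ from the given extension to the wreath product extension $$0\to A^X\to A^X\rtimes X\to X\to 0,$$ and this morphism is an embedding, i.e. $\phi_A$ and $\phi_G$ are monomorphisms of precrossed modules.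
   Context: A precrossed module (over groups) is viewed as a triple $(G,s_G,t_G)$ with $G$ a group and $s_G,t_G\colon G\to G$ group endomorphisms with $t_Gs_G=s_G$ and $s_Gt_G=t_G$; morphisms are group homomorphisms commuting with $s$ and $t$. (This category is equivalent to the usual category of precrossed modules.) An extension is a short exact sequence of precrossed modules: $f$ is surjective and $k$ is its kernel. A morphism of extensions over $X$ is a pair of morphisms between the kernel objects and between the middle objects making the evident diagram commute, with the identity on $X$. Reflexive graphs (of sets) are triples $(Y,s_Y,t_Y)$ with $Y$ a set and $s_Y,t_Y\colon Y\to Y$ functions with $t_Ys_Y=s_Y$, $s_Yt_Y=t_Y$; morphisms are functions commuting with $s$ and $t$; this category is denoted $\mathrm{RG}$. Let $\{1,\sigma,\tau\}$ be the monoid with unit $1$ and $\sigma\tau=\sigma$, $\tau\sigma=\tau$ (hence $\sigma\sigma=\sigma$, $\tau\tau=\tau$). It is a reflexive graph with $s(v)=v\sigma$ and $t(v)=v\tau$. For a reflexive graph $Y$ and $u\in\{1,\sigma,\tau\}$, write $u_Y$ for $1_Y$, $s_Y$, $t_Y$ when $u=1,\sigma,\tau$ respectively. For precrossed modules $A$ and $X$, $A^X$ is the precrossed module with underlying set $\mathrm{RG}(\{1,\sigma,\tau\}\times X,A)$ (product of reflexive graphs, operations componentwise), pointwise group multiplication, and operations $s(\phi)(u,x)=\phi(\sigma u,x)$, $t(\phi)(u,x)=\phi(\tau u,x)$. The group $X$ acts on $A^X$ by $\phi^x(u,x')=\phi(u,x'\cdot u_X(x))$. The semi-direct product $A^X\rtimes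 X$ is the set $A^X\times X$ with multiplication $(\phi,x)(\phi',x')=(\phi\cdot\phi'^{x},xx')$ and componentwise operations $s,t$; it is a precrossed module, and the wreath product extension consists of $\phi\mapsto(\phi,e)$ and $(\phi,x)\mapsto x$. *)

theory Defs
  imports "HOL-Algebra.Coset" "HOL-Library.FuncSet"
begin

section \<open>Reflexive graphs of sets\<close>

record 'a rgraph = "'a partial_object" +
  rsrc :: "'a \<Rightarrow> 'a"
  rtgt :: "'a \<Rightarrow> 'a"

definition reflexive_graph :: "'a rgraph \<Rightarrow> bool" where
  "reflexive_graph Y \<longleftrightarrow>
     rsrc Y \<in> carrier Y \<rightarrow> carrier Y \<and> rtgt Y \<in> carrier Y \<rightarrow> carrier Y \<and>
     (\<forall>y\<in>carrier Y. rtgt Y (rsrc Y y) = rsrc Y y \<and> rsrc Y (rtgt Y y) = rtgt Y y)"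

text \<open>Only the values on the carrier matter, so maps agreeing there are the same morphism;
  unique representatives are obtained by intersecting with \<^const>\<open>extensional\<close>.\<close>

definition rg_hom :: "'a rgraph \<Rightarrow> 'b rgraph \<Rightarrow> ('a \<Rightarrow> 'b) set" where
  "rg_hom Y Z = {h \<in> carrier Y \<rightarrow> carrier Z.
     \<forall>y\<in>carrier Y. h (rsrc Y y) = rsrc Z (h y) \<and> h (rtgt Y y) = rtgt Z (h y)}"

definition rg_prod :: "'a rgraph \<Rightarrow> 'b rgraph \<Rightarrow> ('a \<times> 'b) rgraph" where
  "rg_prod Y Z = \<lparr> carrier = carrier Y \<times> carrier Z,
     rsrc = map_prod (rsrc Y) (rsrc Z), rtgt = map_prod (rtgt Y) (rtgt Z) \<rparr>"

text \<open>The monoid \<open>{1, \<sigma>, \<tau>}\<close> with \<open>\<sigma>\<tau> = \<sigma>\<close> and \<open>\<tau>\<sigma> = \<tau>\<close>.\<close>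

datatype st = st_one | st_sigma | st_tau

instantiation st :: monoid_mult
begin

definition one_st :: st where "1 = st_one"

fun times_st :: "st \<Rightarrow> st \<Rightarrow> st" where
  "st_one * v = v"
| "st_sigma * v = st_sigma"
| "st_tau * v = st_tau"

instance
proof
  fix a b c :: st
  show "a * b * c = a * (b * c)" by (cases a) simp_all
  show "1 * a = a" by (simp add: one_st_def)
  show "a * 1 = a" by (cases a) (simp_all add: one_st_def)
qed

end

definition st_rg :: "st rgraph" where
  "st_rg = \<lparr> carrier = UNIV, rsrc = (\<lambda>v. v * st_sigma), rtgt = (\<lambda>v. v * st_tau) \<rparr>"

lemma reflexive_graph_st_rg: "reflexive_graph st_rg"
  by (simp add: reflexive_graph_def st_rg_def mult.assoc)

text \<open>\<open>rg_op Y u\<close> is the operation written \<open>u\<^sub>Y\<close>.\<close>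

fun rg_op :: "'a rgraph \<Rightarrow> st \<Rightarrow> 'a \<Rightarrow> 'a" where
  "rg_op Y st_one y = y"
| "rg_op Y st_sigma y = rsrc Y y"
| "rg_op Y st_tau y = rtgt Y y"


section \<open>Precrossed modules\<close>

record 'a precrossed = "'a monoid" +
  src :: "'a \<Rightarrow> 'a"
  tgt :: "'a \<Rightarrow> 'a"

definition precrossed_module :: "'a precrossed \<Rightarrow> bool" where
  "precrossed_module G \<longleftrightarrow> group G \<and> src G \<in> hom G G \<and> tgt G \<in> hom G G \<and>
     (\<forall>g\<in>carrier G. tgt G (src G g) = src G g \<and> src G (tgt G g) = tgt G g)"

definition rg_of :: "'a precrossed \<Rightarrow> 'a rgraph" where
  "rg_of G = \<lparr> carrier = carrier G, rsrc = src G, rtgt = tgt G \<rparr>"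

lemma reflexive_graph_rg_of: "precrossed_module G \<Longrightarrow> reflexive_graph (rg_of G)"
  by (auto simp: precrossed_module_def reflexive_graph_def rg_of_def hom_def)

definition precrossed_hom :: "'a precrossed \<Rightarrow> 'b precrossed \<Rightarrow> ('a \<Rightarrow> 'b) set" where
  "precrossed_hom G H = {h \<in> hom G H.
     \<forall>g\<in>carrier G. h (src G g) = src H (h g) \<and> h (tgt G g) = tgt H (h g)}"

text \<open>Monomorphisms in the categorical sense.  The test objects have elements of the type
  given by the first argument, over which one cannot quantify inside the definition.\<close>

definition precrossed_mono ::
  "'t itself \<Rightarrow> 'a precrossed \<Rightarrow> 'b precrossed \<Rightarrow> ('a \<Rightarrow> 'b) \<Rightarrow> bool" where
  "precrossed_mono _ G H m \<longleftrightarrow> m \<in> precrossed_hom G H \<and>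
     (\<forall>(T :: 't precrossed) p q.
        precrossed_module T \<and> p \<in> precrossed_hom T G \<and> q \<in> precrossed_hom T G \<and>
        (\<forall>y\<in>carrier T. m (p y) = m (q y)) \<longrightarrow> (\<forall>y\<in>carrier T. p y = q y))"


section \<open>Extensions\<close>

definition pxm_extension ::
  "'a precrossed \<Rightarrow> ('a \<Rightarrow> 'g) \<Rightarrow> 'g precrossed \<Rightarrow> ('g \<Rightarrow> 'x) \<Rightarrow> 'x precrossed \<Rightarrow> bool" where
  "pxm_extension A k G f X \<longleftrightarrow>
     precrossed_module A \<and> precrossed_module G \<and> precrossed_module X \<and>
     k \<in> precrossed_hom A G \<and> f \<in> precrossed_hom G X \<and>
     inj_on k (carrier A) \<and> k ` carrier A = kernel G X f \<and> f ` carrier G = carrier X"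

definition pxm_extension_morphism ::
  "'x precrossed \<Rightarrow>
   'a precrossed \<Rightarrow> ('a \<Rightarrow> 'g) \<Rightarrow> 'g precrossed \<Rightarrow> ('g \<Rightarrow> 'x) \<Rightarrow>
   'b precrossed \<Rightarrow> ('b \<Rightarrow> 'h) \<Rightarrow> 'h precrossed \<Rightarrow> ('h \<Rightarrow> 'x) \<Rightarrow>
   ('a \<Rightarrow> 'b) \<Rightarrow> ('g \<Rightarrow> 'h) \<Rightarrow> bool" where
  "pxm_extension_morphism X A k G f B k' H f' \<alpha> \<gamma> \<longleftrightarrow>
     pxm_extension A k G f X \<and> pxm_extension B k' H f' X \<and>
     \<alpha> \<in> precrossed_hom A B \<and> \<gamma> \<in> precrossed_hom G H \<and>
     (\<forall>a\<in>carrier A. \<gamma> (k a) = k' (\<alpha> a)) \<and>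
     (\<forall>g\<in>carrier G. f' (\<gamma> g) = f g)"

definition rg_section ::
  "'g precrossed \<Rightarrow> ('g \<Rightarrow> 'x) \<Rightarrow> 'x precrossed \<Rightarrow> ('x \<Rightarrow> 'g) \<Rightarrow> bool" where
  "rg_section G f X \<theta> \<longleftrightarrow>
     \<theta> \<in> rg_hom (rg_of X) (rg_of G) \<and> (\<forall>x\<in>carrier X. f (\<theta> x) = x)"


section \<open>The wreath product extension\<close>

definition pxm_power :: "'a precrossed \<Rightarrow> 'x precrossed \<Rightarrow> (st \<times> 'x \<Rightarrow> 'a) precrossed" where
  "pxm_power A X =
     \<lparr> carrier = rg_hom (rg_prod st_rg (rg_of X)) (rg_of A) \<inter> extensional (UNIV \<times> carrier X),
       mult = (\<lambda>\<phi> \<psi>. \<lambda>p\<in>UNIV \<times> carrier X. \<phi> p \<otimes>\<^bsub>A\<^esub> \<psi> p),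
       one = (\<lambda>p\<in>UNIV \<times> carrier X. \<one>\<^bsub>A\<^esub>),
       src = (\<lambda>\<phi>. \<lambda>(u, x)\<in>UNIV \<times> carrier X. \<phi> (st_sigma * u, x)),
       tgt = (\<lambda>\<phi>. \<lambda>(u, x)\<in>UNIV \<times> carrier X. \<phi> (st_tau * u, x)) \<rparr>"

text \<open>The element written \<open>\<phi>\<^sup>x\<close>.\<close>

definition pxm_power_act ::
  "'x precrossed \<Rightarrow> (st \<times> 'x \<Rightarrow> 'a) \<Rightarrow> 'x \<Rightarrow> (st \<times> 'x \<Rightarrow> 'a)" where
  "pxm_power_act X \<phi> x =
     (\<lambda>(u, x')\<in>UNIV \<times> carrier X. \<phi> (u, x' \<otimes>\<^bsub>X\<^esub> rg_op (rg_of X) u x))"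

definition pxm_wreath ::
  "'a precrossed \<Rightarrow> 'x precrossed \<Rightarrow> ((st \<times> 'x \<Rightarrow> 'a) \<times> 'x) precrossed" where
  "pxm_wreath A X =
     \<lparr> carrier = carrier (pxm_power A X) \<times> carrier X,
       mult = (\<lambda>(\<phi>, x) (\<phi>', x').
                 (\<phi> \<otimes>\<^bsub>pxm_power A X\<^esub> pxm_power_act X \<phi>' x, x \<otimes>\<^bsub>X\<^esub> x')),
       one = (\<one>\<^bsub>pxm_power A X\<^esub>, \<one>\<^bsub>X\<^esub>),
       src = map_prod (src (pxm_power A X)) (src X),
       tgt = map_prod (tgt (pxm_power A X)) (tgt X) \<rparr>"

definition wreath_incl ::
  "'x precrossed \<Rightarrow> (st \<times> 'x \<Rightarrow> 'a) \<Rightarrow> (st \<times> 'x \<Rightarrow> 'a) \<times> 'x" where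
  "wreath_incl X \<phi> = (\<phi>, \<one>\<^bsub>X\<^esub>)"

definition wreath_proj :: "(st \<times> 'x \<Rightarrow> 'a) \<times> 'x \<Rightarrow> 'x" where
  "wreath_proj = snd"


section \<open>The comparison maps\<close>

text \<open>The element \<open>\<theta>(x) \<cdot> h \<cdot> \<theta>(x \<cdot> f(h))\<^sup>-\<^sup>1\<close> of \<open>G\<close>.  The informal formulas identify \<open>A\<close> with
  the kernel of \<open>f\<close> along \<open>k\<close>; here \<open>A\<close> stays abstract, so \<open>k\<close> is applied to elements of \<open>A\<close> and
  \<open>k\<^sup>-\<^sup>1\<close> (meaningful on the image of \<open>k\<close>) to the resulting elements of \<open>G\<close>.\<close>

definition section_twist ::
  "'g precrossed \<Rightarrow> ('g \<Rightarrow> 'x) \<Rightarrow> 'x precrossed \<Rightarrow> ('x \<Rightarrow> 'g) \<Rightarrow> 'x \<Rightarrow> 'g \<Rightarrow> 'g" where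
  "section_twist G f X \<theta> x h = \<theta> x \<otimes>\<^bsub>G\<^esub> h \<otimes>\<^bsub>G\<^esub> inv\<^bsub>G\<^esub> \<theta> (x \<otimes>\<^bsub>X\<^esub> f h)"

definition phi_A ::
  "'a precrossed \<Rightarrow> ('a \<Rightarrow> 'g) \<Rightarrow> 'g precrossed \<Rightarrow> ('g \<Rightarrow> 'x) \<Rightarrow> 'x precrossed \<Rightarrow>
   ('x \<Rightarrow> 'g) \<Rightarrow> 'a \<Rightarrow> (st \<times> 'x \<Rightarrow> 'a)" where
  "phi_A A k G f X \<theta> a = (\<lambda>(u, x)\<in>UNIV \<times> carrier X.
     inv_into (carrier A) k (section_twist G f X \<theta> x (k (rg_op (rg_of A) u a))))"

definition ell ::
  "'a precrossed \<Rightarrow> ('a \<Rightarrow> 'g) \<Rightarrow> 'g precrossed \<Rightarrow> ('g \<Rightarrow> 'x) \<Rightarrow> 'x precrossed \<Rightarrow>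
   ('x \<Rightarrow> 'g) \<Rightarrow> 'g \<Rightarrow> (st \<times> 'x \<Rightarrow> 'a)" where
  "ell A k G f X \<theta> g = (\<lambda>(u, x)\<in>UNIV \<times> carrier X.
     inv_into (carrier A) k (section_twist G f X \<theta> x (rg_op (rg_of G) u g)))"

definition phi_G ::
  "'a precrossed \<Rightarrow> ('a \<Rightarrow> 'g) \<Rightarrow> 'g precrossed \<Rightarrow> ('g \<Rightarrow> 'x) \<Rightarrow> 'x precrossed \<Rightarrow>
   ('x \<Rightarrow> 'g) \<Rightarrow> 'g \<Rightarrow> (st \<times> 'x \<Rightarrow> 'a) \<times> 'x" where
  "phi_G A k G f X \<theta> g = (ell A k G f X \<theta> g, f g)"

end

theory Submission
  imports Defs
begin

text \<open>
  Write \<open>\<langle>x, h\<rangle> = \<theta>(x) h \<theta>(x f(h))\<^sup>-\<^sup>1\<close>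
  and \<open>L\<^sub>g(u, x) = \<langle>x, u(g)\<rangle>\<close>.  Choosing coset representatives \<open>\<theta>(x)\<close> of the kernel, the element
  \<open>h\<close> carries the coset over \<open>x\<close> to the coset over \<open>x f(h)\<close>, and \<open>\<langle>x, h\<rangle>\<close> is the kernel element that
  measures this motion against the representatives: this is the Kaloujnine--Krasner embedding for
  groups.  Everything follows from two identities.

  \<^item> The cocycle identity \<open>\<langle>x, h h'\<rangle> = \<langle>x, h\<rangle> \<langle>x f(h), h'\<rangle>\<close>: the inner representatives cancel.  It makes
    \<open>g \<mapsto> (L\<^sub>g, f(g))\<close> multiplicative, since translation by \<open>f(h)\<close> is how the semi-direct product twists
    its second factor.

  \<^item> Naturality \<open>v(\<langle>x, h\<rangle>) = \<langle>v(x), v(h)\<rangle>\<close> for \<open>v\<close> in the monoid \<open>{1, \<sigma>, \<tau>}\<close>: all operations are group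
    homomorphisms and \<open>\<theta>\<close> commutes with them.  It makes \<open>L\<^sub>g\<close> a morphism of reflexive graphs.

  Injectivity holds because \<open>L\<^sub>g(1, e) = \<theta>(e) g \<theta>(f(g))\<^sup>-\<^sup>1\<close> and \<open>f(g)\<close> together determine \<open>g\<close>; the
  map on kernels is the restriction of \<open>L\<close> along \<open>k\<close>, so its properties are inherited.

  Source and target never need separate treatment.  A precrossed module is a group with a right action of
  the monoid \<open>{1, \<sigma>, \<tau>}\<close> by endomorphisms, where \<open>u v\<close> acts as first \<open>u\<close>, then \<open>v\<close>, and morphisms are
  the equivariant homomorphisms.  In this language an element of \<open>A\<^sup>X\<close> is a map with
  \<open>\<phi>(u v, v(x)) = v(\<phi>(u, x))\<close>, and \<open>w\<close> acts on it by \<open>\<phi>(u, x) \<mapsto> \<phi>(w u, x)\<close>.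
\<close>

section \<open>Precrossed modules as groups with a monoid action\<close>

abbreviation pxm_op :: "'a precrossed \<Rightarrow> st \<Rightarrow> 'a \<Rightarrow> 'a" where
  "pxm_op G \<equiv> rg_op (rg_of G)"

lemma rg_of_simps [simp]: "rsrc (rg_of G) = src G" "rtgt (rg_of G) = tgt G"
  by (simp_all add: rg_of_def)

lemma pxm_op_simps [simp]:
  "pxm_op G st_one = (\<lambda>g. g)" "pxm_op G st_sigma = src G" "pxm_op G st_tau = tgt G"
  by (simp_all add: fun_eq_iff)

lemma all_st: "(\<forall>u. P u) \<longleftrightarrow> P st_one \<and> P st_sigma \<and> P st_tau"
  by (metis st.exhaust)

lemma st_mult_one [simp]: "u * st_one = u"
  by (cases u) simp_all

text \<open>The relations \<open>\<sigma> \<sigma> = \<sigma>\<close> and \<open>\<tau> \<tau> = \<tau>\<close> follow from the other two: \<open>s s = s (t s) = (s t) s = t s = s\<close>,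
  and symmetrically for \<open>t\<close>.\<close>

lemma precrossed_module_iff_monoid_action:
  "precrossed_module G \<longleftrightarrow> group G \<and> (\<forall>u. pxm_op G u \<in> hom G G) \<and>
     (\<forall>u v. \<forall>g\<in>carrier G. pxm_op G (u * v) g = pxm_op G v (pxm_op G u g))"
proof
  assume G: "precrossed_module G"
  have "src G (src G g) = src G g \<and> tgt G (tgt G g) = tgt G g" if "g \<in> carrier G" for g
    using G that unfolding precrossed_module_def by (metis hom_in_carrier)
  moreover have "pxm_op G st_one \<in> hom G G"
    by (auto simp: hom_def)
  ultimately show "group G \<and> (\<forall>u. pxm_op G u \<in> hom G G) \<and>
      (\<forall>u v. \<forall>g\<in>carrier G. pxm_op G (u * v) g = pxm_op G v (pxm_op G u g))"
    using G by (simp add: all_st precrossed_module_def hom_def)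
next
  assume "group G \<and> (\<forall>u. pxm_op G u \<in> hom G G) \<and>
     (\<forall>u v. \<forall>g\<in>carrier G. pxm_op G (u * v) g = pxm_op G v (pxm_op G u g))"
  then show "precrossed_module G"
    by (simp add: all_st precrossed_module_def hom_def)
qed

lemma precrossed_hom_iff_equivariant:
  "h \<in> precrossed_hom G H \<longleftrightarrow>
     h \<in> hom G H \<and> (\<forall>v. \<forall>g\<in>carrier G. h (pxm_op G v g) = pxm_op H v (h g))"
  by (auto simp: precrossed_hom_def all_st)

locale pxm = group G for G :: "'a precrossed" (structure) +
  assumes op_hom: "pxm_op G u \<in> hom G G"
    and op_comp: "g \<in> carrier G \<Longrightarrow> pxm_op G (u * v) g = pxm_op G v (pxm_op G u g)"
begin

lemma op_closed [simp]: "g \<in> carrier G \<Longrightarrow> pxm_op G u g \<in> carrier G"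
  using op_hom by (rule hom_in_carrier)

lemma op_mult:
  "g \<in> carrier G \<Longrightarrow> h \<in> carrier G \<Longrightarrow> pxm_op G u (g \<otimes> h) = pxm_op G u g \<otimes> pxm_op G u h"
  using op_hom by (rule hom_mult)

lemma op_one: "pxm_op G u \<one> = \<one>"
  using op_hom by (simp add: hom_one is_group)

lemma op_inv: "g \<in> carrier G \<Longrightarrow> pxm_op G u (inv g) = inv (pxm_op G u g)"
  by (metis group_hom.hom_inv group_hom.intro group_hom_axioms.intro is_group op_hom)

end

lemma pxm_iff: "pxm G \<longleftrightarrow> precrossed_module G"
  by (auto simp: pxm_def pxm_axioms_def precrossed_module_iff_monoid_action)

lemma precrossed_monoI_inj:
  assumes "m \<in> precrossed_hom G H" and "inj_on m (carrier G)"
  shows "precrossed_mono TYPE('t) G H m"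
  using assms unfolding precrossed_mono_def precrossed_hom_def
  by (metis (mono_tags, lifting) hom_in_carrier inj_onD mem_Collect_eq)

section \<open>The power object\<close>

locale pxm_pair = A: pxm A + X: pxm X
  for A :: "'a precrossed" and X :: "'x precrossed"
begin

abbreviation P where "P \<equiv> pxm_power A X"

lemma power_carrier_iff:
  "\<phi> \<in> carrier P \<longleftrightarrow> \<phi> \<in> extensional (UNIV \<times> carrier X) \<and>
     (\<forall>u. \<forall>x\<in>carrier X. \<phi> (u, x) \<in> carrier A) \<and>
     (\<forall>u v. \<forall>x\<in>carrier X. \<phi> (u * v, pxm_op X v x) = pxm_op A v (\<phi> (u, x)))"
  by (auto simp: pxm_power_def rg_hom_def rg_prod_def st_rg_def rg_of_def all_st Pi_iff)

lemma power_closed [simp]: "\<phi> \<in> carrier P \<Longrightarrow> x \<in> carrier X \<Longrightarrow> \<phi> (u, x) \<in> carrier A"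
  by (simp add: power_carrier_iff)

lemma power_natural:
  "\<phi> \<in> carrier P \<Longrightarrow> x \<in> carrier X \<Longrightarrow> \<phi> (u * v, pxm_op X v x) = pxm_op A v (\<phi> (u, x))"
  by (simp add: power_carrier_iff)

lemma power_eqI:
  assumes "\<phi> \<in> carrier P" "\<psi> \<in> carrier P"
    and "\<And>u x. x \<in> carrier X \<Longrightarrow> \<phi> (u, x) = \<psi> (u, x)"
  shows "\<phi> = \<psi>"
  using assms by (intro extensionalityI[of _ "UNIV \<times> carrier X"]) (auto simp: power_carrier_iff)

lemma power_mult_eval [simp]:
  "x \<in> carrier X \<Longrightarrow> (\<phi> \<otimes>\<^bsub>P\<^esub> \<psi>) (u, x) = \<phi> (u, x) \<otimes>\<^bsub>A\<^esub> \<psi> (u, x)"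
  by (simp add: pxm_power_def)

lemma power_one_eval [simp]: "x \<in> carrier X \<Longrightarrow> \<one>\<^bsub>P\<^esub> (u, x) = \<one>\<^bsub>A\<^esub>"
  by (simp add: pxm_power_def)

lemma power_op_eval [simp]:
  "x \<in> carrier X \<Longrightarrow> pxm_op P w \<phi> (u, x) = \<phi> (w * u, x)"
  by (cases w) (simp_all add: pxm_power_def)

lemma power_mult_closed [simp]:
  assumes "\<phi> \<in> carrier P" "\<psi> \<in> carrier P" shows "\<phi> \<otimes>\<^bsub>P\<^esub> \<psi> \<in> carrier P"
proof -
  have "\<phi> \<otimes>\<^bsub>P\<^esub> \<psi> \<in> extensional (UNIV \<times> carrier X)"
    by (simp add: pxm_power_def)
  with assms show ?thesis
    by (subst power_carrier_iff) (simp add: power_natural A.op_mult)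
qed

lemma power_one_closed [simp]: "\<one>\<^bsub>P\<^esub> \<in> carrier P"
proof -
  have "\<one>\<^bsub>P\<^esub> \<in> extensional (UNIV \<times> carrier X)"
    by (simp add: pxm_power_def)
  then show ?thesis
    by (subst power_carrier_iff) (simp add: A.op_one)
qed

lemma power_op_closed [simp]:
  assumes "\<phi> \<in> carrier P" shows "pxm_op P w \<phi> \<in> carrier P"
proof -
  have "pxm_op P w \<phi> \<in> extensional (UNIV \<times> carrier X)"
    using assms by (cases w) (simp_all add: pxm_power_def)
  with assms show ?thesis
    by (subst power_carrier_iff) (simp add: power_natural flip: mult.assoc)
qed

lemma power_left_inverse:
  assumes "\<phi> \<in> carrier P" shows "\<exists>\<psi>\<in>carrier P. \<psi> \<otimes>\<^bsub>P\<^esub> \<phi> = \<one>\<^bsub>P\<^esub>"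
proof
  let ?\<psi> = "\<lambda>p\<in>UNIV \<times> carrier X. inv\<^bsub>A\<^esub> \<phi> p"
  show inv: "?\<psi> \<in> carrier P"
    using assms by (subst power_carrier_iff) (simp add: power_natural A.op_inv)
  show "?\<psi> \<otimes>\<^bsub>P\<^esub> \<phi> = \<one>\<^bsub>P\<^esub>"
    using assms inv by (intro power_eqI) simp_all
qed

lemma power_group: "group P"
proof (rule groupI)
  fix \<phi> \<psi> \<chi> assume "\<phi> \<in> carrier P" "\<psi> \<in> carrier P" "\<chi> \<in> carrier P"
  then show "\<phi> \<otimes>\<^bsub>P\<^esub> \<psi> \<otimes>\<^bsub>P\<^esub> \<chi> = \<phi> \<otimes>\<^bsub>P\<^esub> (\<psi> \<otimes>\<^bsub>P\<^esub> \<chi>)"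
    by (intro power_eqI) (simp_all add: A.m_assoc)
next
  fix \<phi> assume "\<phi> \<in> carrier P"
  then show "\<one>\<^bsub>P\<^esub> \<otimes>\<^bsub>P\<^esub> \<phi> = \<phi>"
    by (intro power_eqI) simp_all
qed (simp_all add: power_left_inverse)

lemma power_pxm: "pxm P"
proof -
  have "pxm_op P w \<in> hom P P" for w
    by (intro homI power_eqI) simp_all
  moreover have "pxm_op P (u * v) \<phi> = pxm_op P v (pxm_op P u \<phi>)" if "\<phi> \<in> carrier P" for u v \<phi>
    using that by (intro power_eqI) (simp_all add: mult.assoc)
  ultimately show ?thesis
    by (simp add: pxm_def pxm_axioms_def power_group)
qed

end

sublocale pxm_pair \<subseteq> P: pxm P
  by (rule power_pxm)

section \<open>The wreath product extension\<close>

context pxm_pair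
begin

abbreviation act where "act \<equiv> pxm_power_act X"
abbreviation W where "W \<equiv> pxm_wreath A X"

lemma act_eval [simp]:
  "x' \<in> carrier X \<Longrightarrow> act \<phi> x (u, x') = \<phi> (u, x' \<otimes>\<^bsub>X\<^esub> pxm_op X u x)"
  by (simp add: pxm_power_act_def)

text \<open>Translating the second argument by \<open>u(x)\<close>, and not by \<open>x\<close>, is what keeps \<open>\<phi>\<^sup>x\<close> equivariant:
  \<open>v(x' u(x)) = v(x') (u v)(x)\<close>.\<close>

lemma act_closed [simp]:
  assumes "\<phi> \<in> carrier P" "x \<in> carrier X" shows "act \<phi> x \<in> carrier P"
proof -
  have "\<phi> (u * v, pxm_op X v x' \<otimes>\<^bsub>X\<^esub> pxm_op X (u * v) x) = pxm_op A v (\<phi> (u, x' \<otimes>\<^bsub>X\<^esub> pxm_op X u x))"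
    if "x' \<in> carrier X" for u v x'
    using power_natural[of \<phi> "x' \<otimes>\<^bsub>X\<^esub> pxm_op X u x" u v] assms that
    by (simp add: X.op_mult X.op_comp)
  moreover have "act \<phi> x \<in> extensional (UNIV \<times> carrier X)"
    by (simp add: pxm_power_act_def)
  ultimately show ?thesis
    using assms by (subst power_carrier_iff) simp
qed

lemma act_mult:
  "\<phi> \<in> carrier P \<Longrightarrow> \<psi> \<in> carrier P \<Longrightarrow> x \<in> carrier X \<Longrightarrow>
   act (\<phi> \<otimes>\<^bsub>P\<^esub> \<psi>) x = act \<phi> x \<otimes>\<^bsub>P\<^esub> act \<psi> x"
  by (intro power_eqI) simp_all

lemma act_one: "x \<in> carrier X \<Longrightarrow> act \<one>\<^bsub>P\<^esub> x = \<one>\<^bsub>P\<^esub>"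
  by (intro power_eqI) simp_all

lemma act_by_one: "\<phi> \<in> carrier P \<Longrightarrow> act \<phi> \<one>\<^bsub>X\<^esub> = \<phi>"
  by (intro power_eqI) (simp_all add: X.op_one)

text \<open>Despite the exponent notation \<open>\<phi>\<^sup>x\<close> this is a left action, as the semi-direct product requires.\<close>

lemma act_comp:
  "\<phi> \<in> carrier P \<Longrightarrow> x \<in> carrier X \<Longrightarrow> y \<in> carrier X \<Longrightarrow>
   act \<phi> (x \<otimes>\<^bsub>X\<^esub> y) = act (act \<phi> y) x"
  by (intro power_eqI) (simp_all add: X.op_mult X.m_assoc)

lemma op_act:
  "\<phi> \<in> carrier P \<Longrightarrow> x \<in> carrier X \<Longrightarrow>
   pxm_op P w (act \<phi> x) = act (pxm_op P w \<phi>) (pxm_op X w x)"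
  by (intro power_eqI) (simp_all add: X.op_comp)

lemma wreath_carrier: "carrier W = carrier P \<times> carrier X"
  by (simp add: pxm_wreath_def)

lemma wreath_mult:
  "(\<phi>, x) \<otimes>\<^bsub>W\<^esub> (\<psi>, y) = (\<phi> \<otimes>\<^bsub>P\<^esub> act \<psi> x, x \<otimes>\<^bsub>X\<^esub> y)"
  by (simp add: pxm_wreath_def)

lemma wreath_one: "\<one>\<^bsub>W\<^esub> = (\<one>\<^bsub>P\<^esub>, \<one>\<^bsub>X\<^esub>)"
  by (simp add: pxm_wreath_def)

lemma wreath_op: "pxm_op W w (\<phi>, x) = (pxm_op P w \<phi>, pxm_op X w x)"
  by (cases w) (simp_all add: pxm_wreath_def)

lemmas wreath_simps = wreath_carrier wreath_mult wreath_one wreath_op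

lemma wreath_group: "group W"
proof (rule groupI)
  fix p q r assume "p \<in> carrier W" "q \<in> carrier W" "r \<in> carrier W"
  then show "p \<otimes>\<^bsub>W\<^esub> q \<otimes>\<^bsub>W\<^esub> r = p \<otimes>\<^bsub>W\<^esub> (q \<otimes>\<^bsub>W\<^esub> r)"
    by (auto simp: wreath_simps act_mult act_comp P.m_assoc X.m_assoc)
next
  fix p assume "p \<in> carrier W"
  then obtain \<phi> x where p: "p = (\<phi>, x)" "\<phi> \<in> carrier P" "x \<in> carrier X"
    by (auto simp: wreath_simps)
  let ?q = "(act (inv\<^bsub>P\<^esub> \<phi>) (inv\<^bsub>X\<^esub> x), inv\<^bsub>X\<^esub> x)"
  have "?q \<otimes>\<^bsub>W\<^esub> p = \<one>\<^bsub>W\<^esub>"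
    using p by (simp add: wreath_simps act_one flip: act_mult)
  with p show "\<exists>q\<in>carrier W. q \<otimes>\<^bsub>W\<^esub> p = \<one>\<^bsub>W\<^esub>"
    by (intro bexI[of _ ?q]) (simp_all add: wreath_simps)
qed (auto simp: wreath_simps act_by_one)

lemma wreath_pxm: "pxm W"
proof -
  have "pxm_op W w \<in> hom W W" for w
    by (rule homI) (auto simp: wreath_simps P.op_mult X.op_mult op_act)
  moreover have "pxm_op W (u * v) p = pxm_op W v (pxm_op W u p)" if "p \<in> carrier W" for u v p
    using that by (auto simp: wreath_simps P.op_comp X.op_comp)
  ultimately show ?thesis
    by (simp add: pxm_def pxm_axioms_def wreath_group)
qed

lemma wreath_incl_hom: "wreath_incl X \<in> precrossed_hom P W"
  by (auto simp: precrossed_hom_iff_equivariant wreath_incl_def wreath_simps act_by_one X.op_one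
      intro!: homI)

lemma wreath_proj_hom: "wreath_proj \<in> precrossed_hom W X"
  by (auto simp: precrossed_hom_iff_equivariant wreath_proj_def wreath_simps intro!: homI)

lemma wreath_extension: "pxm_extension P (wreath_incl X) W wreath_proj X"
proof -
  have "inj_on (wreath_incl X) (carrier P)"
    by (simp add: inj_on_def wreath_incl_def)
  moreover have "wreath_incl X ` carrier P = kernel W X wreath_proj"
    by (auto simp: kernel_def wreath_incl_def wreath_proj_def wreath_carrier)
  moreover have "wreath_proj ` carrier W = carrier X"
    using power_one_closed by (force simp: wreath_proj_def wreath_carrier)
  ultimately show ?thesis
    using P.pxm_axioms wreath_pxm X.pxm_axioms wreath_incl_hom wreath_proj_hom
    by (simp add: pxm_extension_def pxm_iff)
qed

end

section \<open>The comparison morphism of a sectioned extension\<close>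

locale sectioned_extension =
  fixes A :: "'a precrossed" and k :: "'a \<Rightarrow> 'g" and G :: "'g precrossed"
    and f :: "'g \<Rightarrow> 'x" and X :: "'x precrossed" and \<theta> :: "'x \<Rightarrow> 'g"
  assumes extension: "pxm_extension A k G f X" and section_\<theta>: "rg_section G f X \<theta>"

sublocale sectioned_extension \<subseteq> pxm_pair A X
  using extension by (simp add: pxm_pair_def pxm_iff pxm_extension_def)

sublocale sectioned_extension \<subseteq> G: pxm G
  using extension by (simp add: pxm_iff pxm_extension_def)

sublocale sectioned_extension \<subseteq> k: group_hom A G k
  using extension A.is_group G.is_group
  by (simp add: group_hom_def group_hom_axioms_def pxm_extension_def precrossed_hom_def)

sublocale sectioned_extension \<subseteq> f: group_hom G X f
  using extension G.is_group X.is_group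
  by (simp add: group_hom_def group_hom_axioms_def pxm_extension_def precrossed_hom_def)

context sectioned_extension
begin

abbreviation twist where "twist \<equiv> section_twist G f X \<theta>"
abbreviation L where "L \<equiv> ell A k G f X \<theta>"

lemma k_op: "a \<in> carrier A \<Longrightarrow> k (pxm_op A v a) = pxm_op G v (k a)"
  using extension by (simp add: pxm_extension_def precrossed_hom_iff_equivariant)

lemma f_op: "g \<in> carrier G \<Longrightarrow> f (pxm_op G v g) = pxm_op X v (f g)"
  using extension by (simp add: pxm_extension_def precrossed_hom_iff_equivariant)

lemma k_inj: "a \<in> carrier A \<Longrightarrow> b \<in> carrier A \<Longrightarrow> k a = k b \<longleftrightarrow> a = b"
  using extension by (auto simp: pxm_extension_def dest: inj_onD)

lemma k_image: "k ` carrier A = {g \<in> carrier G. f g = \<one>\<^bsub>X\<^esub>}"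
  using extension by (simp add: pxm_extension_def kernel_def)

lemma f_k: "a \<in> carrier A \<Longrightarrow> f (k a) = \<one>\<^bsub>X\<^esub>"
  using k_image by blast

lemma \<theta>_closed [simp]: "x \<in> carrier X \<Longrightarrow> \<theta> x \<in> carrier G"
  using section_\<theta> by (auto simp: rg_section_def rg_hom_def rg_of_def)

lemma f_\<theta> [simp]: "x \<in> carrier X \<Longrightarrow> f (\<theta> x) = x"
  using section_\<theta> by (simp add: rg_section_def)

lemma \<theta>_op: "x \<in> carrier X \<Longrightarrow> \<theta> (pxm_op X v x) = pxm_op G v (\<theta> x)"
  using section_\<theta> by (cases v) (simp_all add: rg_section_def rg_hom_def rg_of_def)

lemma twist_closed [simp]: "x \<in> carrier X \<Longrightarrow> h \<in> carrier G \<Longrightarrow> twist x h \<in> carrier G"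
  by (simp add: section_twist_def)

lemma twist_in_kernel:
  assumes "x \<in> carrier X" "h \<in> carrier G" shows "twist x h \<in> k ` carrier A"
proof -
  have "f (twist x h) = \<one>\<^bsub>X\<^esub>"
    using assms by (simp add: section_twist_def)
  with assms show ?thesis by (simp add: k_image)
qed

text \<open>The inverse of \<open>\<theta>(x f(h))\<close> closing the first factor cancels the representative opening the
  second.\<close>

lemma twist_cocycle:
  assumes "x \<in> carrier X" "h \<in> carrier G" "h' \<in> carrier G"
  shows "twist x (h \<otimes>\<^bsub>G\<^esub> h') = twist x h \<otimes>\<^bsub>G\<^esub> twist (x \<otimes>\<^bsub>X\<^esub> f h) h'"
proof -
  let ?y = "\<theta> (x \<otimes>\<^bsub>X\<^esub> f h)"
  have "inv\<^bsub>G\<^esub> ?y \<otimes>\<^bsub>G\<^esub> (?y \<otimes>\<^bsub>G\<^esub> z) = z" if "z \<in> carrier G" for z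
    using assms that by (simp flip: G.m_assoc)
  with assms show ?thesis
    by (simp add: section_twist_def G.m_assoc X.m_assoc)
qed

lemma twist_natural:
  "x \<in> carrier X \<Longrightarrow> h \<in> carrier G \<Longrightarrow>
   pxm_op G v (twist x h) = twist (pxm_op X v x) (pxm_op G v h)"
  by (simp add: section_twist_def G.op_mult G.op_inv f_op X.op_mult flip: \<theta>_op)

lemma k_ell:
  "g \<in> carrier G \<Longrightarrow> x \<in> carrier X \<Longrightarrow> k (L g (u, x)) = twist x (pxm_op G u g)"
  by (simp add: ell_def f_inv_into_f twist_in_kernel)

text \<open>Values of \<open>L\<^sub>g\<close> are compared after applying the injection \<open>k\<close>, where they become twists.\<close>

lemma ell_closed [simp]:
  assumes "g \<in> carrier G" shows "L g \<in> carrier P"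
proof -
  have val: "L g (u, x) \<in> carrier A" if "x \<in> carrier X" for u x
    using assms that by (simp add: ell_def inv_into_into twist_in_kernel)
  have "L g (u * v, pxm_op X v x) = pxm_op A v (L g (u, x))" if "x \<in> carrier X" for u v x
  proof -
    have "k (L g (u * v, pxm_op X v x)) = k (pxm_op A v (L g (u, x)))"
      using assms that val by (simp add: k_ell k_op twist_natural G.op_comp)
    then show ?thesis
      using val that k_inj by simp
  qed
  moreover have "L g \<in> extensional (UNIV \<times> carrier X)"
    by (simp add: ell_def)
  ultimately show ?thesis
    using val by (simp add: power_carrier_iff)
qed

lemma power_eqI_k:
  assumes "\<phi> \<in> carrier P" "\<psi> \<in> carrier P"
    and "\<And>u x. x \<in> carrier X \<Longrightarrow> k (\<phi> (u, x)) = k (\<psi> (u, x))"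
  shows "\<phi> = \<psi>"
  using assms k_inj by (intro power_eqI) simp_all

lemma ell_mult:
  "g \<in> carrier G \<Longrightarrow> h \<in> carrier G \<Longrightarrow> L (g \<otimes>\<^bsub>G\<^esub> h) = L g \<otimes>\<^bsub>P\<^esub> act (L h) (f g)"
  by (intro power_eqI_k) (simp_all add: k_ell G.op_mult twist_cocycle f_op)

lemma ell_op: "g \<in> carrier G \<Longrightarrow> L (pxm_op G w g) = pxm_op P w (L g)"
  by (intro power_eqI_k) (simp_all add: k_ell G.op_comp)

text \<open>Evaluating at \<open>(1, e)\<close> recovers \<open>\<theta>(e) g \<theta>(f(g))\<^sup>-\<^sup>1\<close>, hence \<open>g\<close> once \<open>f(g)\<close> is known.\<close>

lemma ell_and_f_determine:
  assumes "g \<in> carrier G" "h \<in> carrier G" "L g = L h" "f g = f h"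
  shows "g = h"
proof -
  have "twist \<one>\<^bsub>X\<^esub> g = twist \<one>\<^bsub>X\<^esub> h"
    using k_ell[of g "\<one>\<^bsub>X\<^esub>" st_one] k_ell[of h "\<one>\<^bsub>X\<^esub>" st_one] assms by simp
  with assms show ?thesis
    by (simp add: section_twist_def)
qed

lemma phi_G_hom: "phi_G A k G f X \<theta> \<in> precrossed_hom G W"
  by (auto simp: precrossed_hom_iff_equivariant phi_G_def wreath_simps ell_mult ell_op f_op
      intro!: homI)

lemma phi_G_inj: "inj_on (phi_G A k G f X \<theta>) (carrier G)"
  by (auto simp: inj_on_def phi_G_def intro: ell_and_f_determine)

lemma phi_A_eq_ell: "a \<in> carrier A \<Longrightarrow> phi_A A k G f X \<theta> a = L (k a)"
  by (simp add: phi_A_def ell_def k_op cong: restrict_cong)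

text \<open>On the kernel the twisting action is by \<open>f(k(a)) = e\<close>, so \<open>L\<close> becomes a genuine homomorphism.\<close>

lemma phi_A_hom: "phi_A A k G f X \<theta> \<in> precrossed_hom A P"
  by (auto simp: precrossed_hom_iff_equivariant phi_A_eq_ell ell_mult f_k act_by_one k_op ell_op
      intro!: homI)

lemma phi_A_inj: "inj_on (phi_A A k G f X \<theta>) (carrier A)"
proof (rule inj_onI)
  fix a b assume "a \<in> carrier A" "b \<in> carrier A" "phi_A A k G f X \<theta> a = phi_A A k G f X \<theta> b"
  then show "a = b"
    using ell_and_f_determine[of "k a" "k b"] by (simp add: phi_A_eq_ell f_k k_inj)
qed

lemma phi_extension_morphism:
  "pxm_extension_morphism X A k G f P (wreath_incl X) W wreath_proj
     (phi_A A k G f X \<theta>) (phi_G A k G f X \<theta>)"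
  using extension wreath_extension phi_A_hom phi_G_hom
  by (simp add: pxm_extension_morphism_def phi_A_eq_ell phi_G_def wreath_incl_def wreath_proj_def f_k)

end

section \<open>The embedding theorem\<close>

theorem theorem3p11:
  fixes A :: "'a precrossed" and G :: "'g precrossed" and X :: "'x precrossed"
    and k :: "'a \<Rightarrow> 'g" and f :: "'g \<Rightarrow> 'x" and \<theta> :: "'x \<Rightarrow> 'g"
  assumes "pxm_extension A k G f X"
    and "rg_section G f X \<theta>"
  shows
    "(\<forall>a\<in>carrier A. \<forall>u. \<forall>x\<in>carrier X.
        section_twist G f X \<theta> x (k (rg_op (rg_of A) u a)) \<in> k ` carrier A) \<and>
     (\<forall>g\<in>carrier G. \<forall>u. \<forall>x\<in>carrier X.
        section_twist G f X \<theta> x (rg_op (rg_of G) u g) \<in> k ` carrier A) \<and>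
     phi_A A k G f X \<theta> \<in> carrier A \<rightarrow> carrier (pxm_power A X) \<and>
     phi_G A k G f X \<theta> \<in> carrier G \<rightarrow> carrier (pxm_wreath A X) \<and>
     pxm_extension_morphism X A k G f
       (pxm_power A X) (wreath_incl X) (pxm_wreath A X) wreath_proj
       (phi_A A k G f X \<theta>) (phi_G A k G f X \<theta>) \<and>
     precrossed_mono TYPE('t) A (pxm_power A X) (phi_A A k G f X \<theta>) \<and>
     precrossed_mono TYPE('t) G (pxm_wreath A X) (phi_G A k G f X \<theta>) \<and>
     inj_on (phi_A A k G f X \<theta>) (carrier A) \<and>
     inj_on (phi_G A k G f X \<theta>) (carrier G)"
proof -
  interpret sectioned_extension A k G f X \<theta>
    using assms by (simp add: sectioned_extension_def)
  have "phi_A A k G f X \<theta> \<in> carrier A \<rightarrow> carrier P" "phi_G A k G f X \<theta> \<in> carrier G \<rightarrow> carrier W"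
    using phi_A_hom phi_G_hom by (simp_all add: precrossed_hom_def hom_def)
  then show ?thesis
    using phi_A_hom phi_A_inj phi_G_hom phi_G_inj phi_extension_morphism
    by (auto simp: twist_in_kernel intro: precrossed_monoI_inj)
qed

end
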